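(* There exist two simple polygons $P$ and $P'$ with vertices in general position, each having $12$ vertices labeled $0,1,\dots,11$ in counterclockwise order, such that $P$ and $P'$ have identical zero-parity (ZP) stabbing information, and yet the pair $(0,8)$ is an I-edge (internal visibility edge) of $P$ and an E-edge (external visibility edge) of $P'$. In particular, ZP stabbing information does not suffice to distinguish internal from external visibility edges of a simple polygon.
   Context: Polygons are simple polygons in the plane with vertices in general position (no three collinear), labeled by consecutive indices increasing in a counterclockwise traversal of the boundary. For an ordered pair of distinct vertices $(x,y)$ of $P$, let $L$ be the line through them; $L\setminus\{x,y\}$ has three components. $\mathrm{Tail}(x,y)$, $\mathrm{Body}(x,y)$, $\mathrm{Head}(x,y)$ denote the number of edges of $P$ that cross, respectively, the open ray of $L$ ending at $x$ and not containing $y$, the open segment between $x$ and $y$, and the open ray of $L$ starting at $y$ and not containing $x$. (If $xy$ is itself an edge of $P$, this edge is not counted.) The zero-parity of a nonnegative integer is one of the three values "zero", "odd", "even and $>0$". The zero-parity (ZP) stabbing information of $P$ is the collection of the zero-parities of $\mathrm{Tail}(x,y),\mathrm{Body}(x,y),\mathrm{Head}(x,y)$ for all pairs of vertices, indexed by the vertex labels. A pair $xy$ with $\mathrm{Body}(x,y)=0$ is a visibility edge. For nonadjacent vertices $x,y$, a visibility edge is an I-edge (internal) if the open segment $xy$ lies in the interior of $P$, and an E-edge (external) if the open segment $xy$ lies in the exterior of $P$. *)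

theory Defs
  imports "HOL-Complex_Analysis.Complex_Analysis"
begin

text \<open>
  A polygon is the list of its vertices, points of the plane \<^typ>\<open>complex\<close>, in the order of the
  labels. Edge \<open>i\<close> joins vertex \<open>i\<close> to vertex \<open>i + 1\<close>, indices being taken modulo the length.
\<close>

fun polyline :: "complex list \<Rightarrow> real \<Rightarrow> complex" where
  "polyline [] = linepath 0 0"
| "polyline [a] = linepath a a"
| "polyline [a, b] = linepath a b"
| "polyline (a # b # c # xs) = linepath a b +++ polyline (b # c # xs)"

definition polygon_path :: "complex list \<Rightarrow> real \<Rightarrow> complex" where
  "polygon_path P = polyline (P @ [hd P])"

definition polygon_interior :: "complex list \<Rightarrow> complex set" where
  "polygon_interior P = inside (path_image (polygon_path P))"

definition polygon_exterior :: "complex list \<Rightarrow> complex set" where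
  "polygon_exterior P = outside (path_image (polygon_path P))"

definition simple_polygon :: "complex list \<Rightarrow> bool" where
  "simple_polygon P \<longleftrightarrow> length P \<ge> 3 \<and> simple_path (polygon_path P)"

definition counterclockwise :: "complex list \<Rightarrow> bool" where
  "counterclockwise P \<longleftrightarrow> (\<forall>z \<in> polygon_interior P. winding_number (polygon_path P) z = 1)"

definition general_position :: "complex list \<Rightarrow> bool" where
  "general_position P \<longleftrightarrow>
     (\<forall>i j k. i < length P \<and> j < length P \<and> k < length P \<and> i \<noteq> j \<and> j \<noteq> k \<and> i \<noteq> k \<longrightarrow>
        \<not> collinear {P ! i, P ! j, P ! k})"

definition admissible_polygon :: "complex list \<Rightarrow> bool" where
  "admissible_polygon P \<longleftrightarrow> simple_polygon P \<and> general_position P \<and> counterclockwise P"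

definition next_vertex :: "complex list \<Rightarrow> nat \<Rightarrow> nat" where
  "next_vertex P i = Suc i mod length P"

definition adjacent_vertices :: "complex list \<Rightarrow> nat \<Rightarrow> nat \<Rightarrow> bool" where
  "adjacent_vertices P i j \<longleftrightarrow> j = next_vertex P i \<or> i = next_vertex P j"

text \<open>The open ray that starts at \<open>b\<close> and is contained in the line through \<open>a\<close> and \<open>b\<close>, on the
  side of \<open>b\<close> not containing \<open>a\<close>.\<close>

definition open_ray_beyond :: "complex \<Rightarrow> complex \<Rightarrow> complex set" where
  "open_ray_beyond a b = {b + t *\<^sub>R (b - a) | t. t > 0}"

text \<open>
  The number of edges that cross the component \<open>R\<close> of the line through vertices \<open>i\<close> and \<open>j\<close> with
  these two vertices removed. In general position no vertex lies on \<open>R\<close>, so every edge other than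
  the pair \<open>ij\<close> itself that meets \<open>R\<close> does so transversally, in a point of its relative interior.
\<close>

definition crossings :: "complex list \<Rightarrow> nat \<Rightarrow> nat \<Rightarrow> complex set \<Rightarrow> nat" where
  "crossings P i j R =
     card {k. k < length P \<and> {k, next_vertex P k} \<noteq> {i, j} \<and>
              closed_segment (P ! k) (P ! next_vertex P k) \<inter> R \<noteq> {}}"

definition Tail :: "complex list \<Rightarrow> nat \<Rightarrow> nat \<Rightarrow> nat" where
  "Tail P i j = crossings P i j (open_ray_beyond (P ! j) (P ! i))"

definition Body :: "complex list \<Rightarrow> nat \<Rightarrow> nat \<Rightarrow> nat" where
  "Body P i j = crossings P i j (open_segment (P ! i) (P ! j))"

definition Head :: "complex list \<Rightarrow> nat \<Rightarrow> nat \<Rightarrow> nat" where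
  "Head P i j = crossings P i j (open_ray_beyond (P ! i) (P ! j))"

datatype zero_parity = ZP_Zero | ZP_Odd | ZP_EvenPos

definition zero_parity_of :: "nat \<Rightarrow> zero_parity" where
  "zero_parity_of m = (if m = 0 then ZP_Zero else if odd m then ZP_Odd else ZP_EvenPos)"

definition zp_stabbing_info ::
  "complex list \<Rightarrow> nat \<times> nat \<rightharpoonup> zero_parity \<times> zero_parity \<times> zero_parity" where
  "zp_stabbing_info P = (\<lambda>(i, j).
     if i < length P \<and> j < length P \<and> i \<noteq> j
     then Some (zero_parity_of (Tail P i j), zero_parity_of (Body P i j),
                zero_parity_of (Head P i j))
     else None)"

definition visibility_edge :: "complex list \<Rightarrow> nat \<Rightarrow> nat \<Rightarrow> bool" where
  "visibility_edge P i j \<longleftrightarrow> i < length P \<and> j < length P \<and> i \<noteq> j \<and> Body P i j = 0"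

definition I_edge :: "complex list \<Rightarrow> nat \<Rightarrow> nat \<Rightarrow> bool" where
  "I_edge P i j \<longleftrightarrow> visibility_edge P i j \<and> \<not> adjacent_vertices P i j \<and>
     open_segment (P ! i) (P ! j) \<subseteq> polygon_interior P"

definition E_edge :: "complex list \<Rightarrow> nat \<Rightarrow> nat \<Rightarrow> bool" where
  "E_edge P i j \<longleftrightarrow> visibility_edge P i j \<and> \<not> adjacent_vertices P i j \<and>
     open_segment (P ! i) (P ! j) \<subseteq> polygon_exterior P"

text \<open>
  ZP stabbing information distinguishes internal from external visibility edges if some function
  of this information alone tells, for every nonadjacent visible pair of every polygon, whether
  it is an I-edge or an E-edge.
\<close>

definition zp_distinguishes_internal_external :: bool where
  "zp_distinguishes_internal_external \<longleftrightarrow>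
     (\<exists>internal. \<forall>P i j. admissible_polygon P \<longrightarrow>
        (I_edge P i j \<longrightarrow> internal (zp_stabbing_info P) i j) \<and>
        (E_edge P i j \<longrightarrow> \<not> internal (zp_stabbing_info P) i j))"

end

(*
  The theorem only needs one pair of polygons with integer vertices. Whether an edge meets the tail,
  body or head of a pair of vertices, and whether two edges are disjoint, depends only on signs of
  integer orientation determinants, so simplicity, general position and the equality of the two
  stabbing tables are finite integer computations. The interior, the orientation of the boundary and
  the type of the visibility edge 0 8 follow from winding numbers: around a point off the polygon,
  the winding number is the signed number of edges crossing the horizontal ray to its right, and for
  a simple polygon it vanishes exactly in the exterior. The open diagonal 0 8 is connected and misses
  the polygon, hence its side is decided at its midpoint.
*)
theory Submission
  imports Defs
begin

subsection \<open>Segments, rays and the orientation determinant\<close>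

text \<open>Twice the signed area of the triangle \<open>a b c\<close>: positive exactly when
  \<open>c\<close> lies to the left of the directed line from \<open>a\<close> to
  \<open>b\<close>.\<close>

definition orient :: "complex \<Rightarrow> complex \<Rightarrow> complex \<Rightarrow> real" where
  "orient a b c = (Re b - Re a) * (Im c - Im a) - (Im b - Im a) * (Re c - Re a)"

lemma orient_self [simp]: "orient a a c = 0" "orient a b a = 0" "orient a b b = 0"
  by (simp_all add: orient_def)

text \<open>The determinant is affine in its last argument; this turns incidences of segments and
  lines into sign conditions at endpoints.\<close>

lemma orient_affine:
  "orient a b ((1 - s) *\<^sub>R u + s *\<^sub>R v) = (1 - s) * orient a b u + s * orient a b v"
  by (simp add: orient_def algebra_simps)

lemma collinear_imp_orient_eq_0:
  assumes "collinear {a, b, c}"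
  shows "orient a b c = 0"
proof -
  obtain u where u: "\<And>x y. x \<in> {a, b, c} \<Longrightarrow> y \<in> {a, b, c} \<Longrightarrow> \<exists>t. x - y = t *\<^sub>R u"
    using assms unfolding collinear_def by blast
  obtain s t where "b - a = s *\<^sub>R u" "c - a = t *\<^sub>R u"
    using u[of b a] u[of c a] by auto
  then have "Re b - Re a = s * Re u" "Im b - Im a = s * Im u"
    "Re c - Re a = t * Re u" "Im c - Im a = t * Im u"
    by (simp_all add: complex_eq_iff)
  then show ?thesis by (simp add: orient_def)
qed

text \<open>Used in the form: a segment whose endpoints lie strictly on one side of a line misses
  that line.\<close>

lemma convex_comb_same_sign:
  fixes x y s :: real
  assumes "x * y > 0" "0 \<le> s" "s \<le> 1"
  shows "(1 - s) * x + s * y \<noteq> 0"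
proof (cases "x > 0")
  case True
  then have "y > 0" using assms by (simp add: zero_less_mult_iff)
  show ?thesis
  proof (cases "s = 0")
    case False
    then have "s * y > 0" "(1 - s) * x \<ge> 0" using True \<open>y > 0\<close> assms by auto
    then show ?thesis by linarith
  qed (use True in auto)
next
  case False
  then have "x < 0" "y < 0" using assms by (auto simp: zero_less_mult_iff)
  show ?thesis
  proof (cases "s = 0")
    case False
    then have "s * y < 0" "(1 - s) * x \<le> 0" using \<open>x < 0\<close> \<open>y < 0\<close> assms
      by (auto simp: mult_pos_neg mult_nonneg_nonpos)
    then show ?thesis by linarith
  qed (use \<open>x < 0\<close> in auto)
qed

text \<open>The sign condition puts one of the segments strictly on one side of the line through the
  other.\<close>

lemma closed_segment_disjoint_orient:
  assumes "orient a b c * orient a b d > 0 \<or> orient c d a * orient c d b > 0"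
  shows "closed_segment a b \<inter> closed_segment c d = {}"
proof -
  have *: "closed_segment p q \<inter> closed_segment u v = {}"
    if "orient p q u * orient p q v > 0" for p q u v
  proof -
    { fix x assume "x \<in> closed_segment p q" "x \<in> closed_segment u v"
      then obtain s t where "0 \<le> s" "s \<le> 1" "x = (1 - s) *\<^sub>R u + s *\<^sub>R v"
        "x = (1 - t) *\<^sub>R p + t *\<^sub>R q"
        by (auto simp: closed_segment_def)
      then have "(1 - s) * orient p q u + s * orient p q v = 0"
        by (metis add.right_neutral mult_zero_right orient_affine orient_self(2,3))
      then have False using convex_comb_same_sign[OF that \<open>0 \<le> s\<close> \<open>s \<le> 1\<close>] by simp }
    then show ?thesis by blast
  qed
  from assms show ?thesis using *[of a b c d] *[of c d a b] by blast
qed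

text \<open>At the point of \<open>b c\<close> with parameter \<open>s\<close> the determinant of
  the line \<open>a b\<close> equals \<open>s * orient a b c\<close>, which vanishes only for
  \<open>s = 0\<close>, that is, at \<open>b\<close>.\<close>

lemma closed_segment_Int_adjacent:
  assumes "orient a b c \<noteq> 0"
  shows "closed_segment a b \<inter> closed_segment b c = {b}"
proof -
  { fix x assume "x \<in> closed_segment a b" "x \<in> closed_segment b c"
    then obtain s t where "x = (1 - s) *\<^sub>R b + s *\<^sub>R c" "x = (1 - t) *\<^sub>R a + t *\<^sub>R b"
      by (auto simp: closed_segment_def)
    then have "s * orient a b c = 0" "x = (1 - s) *\<^sub>R b + s *\<^sub>R c"
      by (metis add_0 mult_zero_right add.right_neutral orient_affine orient_self(2,3))+
    then have "x = b" using assms by simp }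
  then show ?thesis by auto
qed

text \<open>Tail, body and head of the line through \<open>a\<close> and \<open>b\<close> are the sets of points
  \<open>a + t (b - a)\<close> with \<open>t < 0\<close>, \<open>0 < t < 1\<close> and \<open>t > 1\<close>. The parameter of the
  crossing point with the line \<open>u v\<close> is \<open>orient u v a / (orient u v a - orient u v b)\<close>.\<close>

lemma closed_segment_meets_line_part_iff:
  assumes ab: "a \<noteq> b" and T: "0 \<notin> T" "1 \<notin> T"
    and u: "orient a b u = 0 \<Longrightarrow> u = a \<or> u = b"
    and v: "orient a b v = 0 \<Longrightarrow> v = a \<or> v = b"
    and uv: "orient a b u \<noteq> 0 \<or> orient a b v \<noteq> 0"
  shows "closed_segment u v \<inter> {a + t *\<^sub>R (b - a) | t. t \<in> T} \<noteq> {} \<longleftrightarrow>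
    orient a b u * orient a b v < 0 \<and> orient u v a / (orient u v a - orient u v b) \<in> T"
    (is "?L \<longleftrightarrow> ?R")
proof -
  \<comment> \<open>Both sides are the cross product of \<open>b - a\<close> and
    \<open>v - u\<close>.\<close>
  have diff: "orient u v a - orient u v b = orient a b v - orient a b u"
    by (simp add: orient_def algebra_simps)
  have not_end: "a + t *\<^sub>R (b - a) \<noteq> a" "a + t *\<^sub>R (b - a) \<noteq> b" if "t \<in> T" for t
  proof -
    have "t \<noteq> 0" "t \<noteq> 1" using that T by auto
    show "a + t *\<^sub>R (b - a) \<noteq> a" using \<open>t \<noteq> 0\<close> ab by simp
    have "a + t *\<^sub>R (b - a) - b = (t - 1) *\<^sub>R (b - a)" by (simp add: algebra_simps)
    then show "a + t *\<^sub>R (b - a) \<noteq> b" using \<open>t \<noteq> 1\<close> ab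
      by (metis cancel_comm_monoid_add_class.diff_cancel eq_iff_diff_eq_0 scaleR_eq_0_iff)
  qed
  show ?thesis
  proof
    assume ?L
    then obtain s t where s: "0 \<le> s" "s \<le> 1" and t: "t \<in> T"
      and eq: "(1 - s) *\<^sub>R u + s *\<^sub>R v = a + t *\<^sub>R (b - a)"
      by (auto simp: closed_segment_def)
    have eq': "a + t *\<^sub>R (b - a) = (1 - t) *\<^sub>R a + t *\<^sub>R b" by (simp add: algebra_simps)
    \<comment> \<open>The common point lies on both lines, so both affine determinants vanish
      there.\<close>
    have 0: "(1 - s) * orient a b u + s * orient a b v = 0"
      using orient_affine[of a b s u v] orient_affine[of a b t a b] eq eq' by simp
    have 1: "(1 - t) * orient u v a + t * orient u v b = 0"
      using orient_affine[of u v s u v] orient_affine[of u v t a b] eq eq' by simp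
    \<comment> \<open>If \<open>u\<close> lay on the line, \<open>uv\<close> would force the meeting
      point to be \<open>u\<close>, hence \<open>a\<close> or \<open>b\<close>, whose parameters 0
      and 1 are not in \<open>T\<close>.\<close>
    have "orient a b u \<noteq> 0"
    proof
      assume z: "orient a b u = 0"
      then have "s = 0" using 0 uv by auto
      then have "u = a + t *\<^sub>R (b - a)" using eq by simp
      then show False using u[OF z] not_end[OF t] by auto
    qed
    moreover have "orient a b v \<noteq> 0"
    proof
      assume z: "orient a b v = 0"
      then have "s = 1" using 0 uv by auto
      then have "v = a + t *\<^sub>R (b - a)" using eq by simp
      then show False using v[OF z] not_end[OF t] by auto
    qed
    ultimately have neg: "orient a b u * orient a b v < 0"
      using convex_comb_same_sign[of "orient a b u" "orient a b v" s] s 0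
      by (metis mult_eq_0_iff linorder_neqE_linordered_idom)
    then have "orient a b u \<noteq> orient a b v" by (auto simp: mult_less_0_iff)
    then have "t = orient u v a / (orient u v a - orient u v b)"
      using 1 diff by (simp add: field_simps)
    then show ?R using neg t by simp
  next
    assume R: ?R
    \<comment> \<open>Cramer's rule: \<open>t\<close> and \<open>s\<close> are the parameters of the
      intersection point on the two lines. Their denominators agree up to sign, so the two points
      are compared coordinatewise after multiplication by \<open>D\<close>.\<close>
    define t where "t = orient u v a / (orient u v a - orient u v b)"
    define s where "s = orient a b u / (orient a b u - orient a b v)"
    have ne: "orient a b u - orient a b v \<noteq> 0" using R by (auto simp: mult_less_0_iff)
    have s: "0 \<le> s" "s \<le> 1"
      using R unfolding s_def by (auto simp: mult_less_0_iff divide_simps)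
    have t': "t * (orient a b u - orient a b v) = - orient u v a"
      using ne unfolding t_def diff by (simp add: field_simps)
    have s': "s * (orient a b u - orient a b v) = orient a b u"
      using ne unfolding s_def by simp
    define D where "D = orient a b u - orient a b v"
    have "D * (Re u + s * (Re v - Re u)) = D * (Re a + t * (Re b - Re a))"
      "D * (Im u + s * (Im v - Im u)) = D * (Im a + t * (Im b - Im a))"
    proof -
      have "D * (Re u + s * (Re v - Re u)) = D * Re u + orient a b u * (Re v - Re u)"
        "D * (Re a + t * (Re b - Re a)) = D * Re a - orient u v a * (Re b - Re a)"
        "D * (Im u + s * (Im v - Im u)) = D * Im u + orient a b u * (Im v - Im u)"
        "D * (Im a + t * (Im b - Im a)) = D * Im a - orient u v a * (Im b - Im a)"
        using arg_cong[OF s', of "\<lambda>x. x * (Re v - Re u)"] arg_cong[OF t', of "\<lambda>x. x * (Re b - Re a)"]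
          arg_cong[OF s', of "\<lambda>x. x * (Im v - Im u)"] arg_cong[OF t', of "\<lambda>x. x * (Im b - Im a)"]
        unfolding D_def by (simp_all add: algebra_simps)
      then show "D * (Re u + s * (Re v - Re u)) = D * (Re a + t * (Re b - Re a))"
        "D * (Im u + s * (Im v - Im u)) = D * (Im a + t * (Im b - Im a))"
        unfolding D_def orient_def by (simp_all add: algebra_simps)
    qed
    moreover have "D \<noteq> 0" using ne by (simp add: D_def)
    ultimately have "Re u + s * (Re v - Re u) = Re a + t * (Re b - Re a)"
      "Im u + s * (Im v - Im u) = Im a + t * (Im b - Im a)"
      by (simp_all only: mult_cancel_left simp_thms)
    then have "(1 - s) *\<^sub>R u + s *\<^sub>R v = a + t *\<^sub>R (b - a)"
      by (simp add: complex_eq_iff algebra_simps)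
    then show ?L using s R unfolding closed_segment_def t_def[symmetric] by blast
  qed
qed

lemma open_ray_beyond_eq: "open_ray_beyond a b = {a + t *\<^sub>R (b - a) | t. t \<in> {1<..}}"
proof -
  have "\<exists>s>1. b + t *\<^sub>R (b - a) = a + s *\<^sub>R (b - a)" if "t > 0" for t
    by (rule exI[of _ "t + 1"]) (use that in \<open>simp add: algebra_simps\<close>)
  moreover have "\<exists>s>0. a + t *\<^sub>R (b - a) = b + s *\<^sub>R (b - a)" if "t > 1" for t
    by (rule exI[of _ "t - 1"]) (use that in \<open>simp add: algebra_simps\<close>)
  ultimately show ?thesis unfolding open_ray_beyond_def by (auto; blast)
qed

lemma open_segment_eq_line_part:
  fixes a b :: complex
  assumes "a \<noteq> b"
  shows "open_segment a b = {a + t *\<^sub>R (b - a) | t. t \<in> {0<..<1}}"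
proof -
  have "(1 - t) *\<^sub>R a + t *\<^sub>R b = a + t *\<^sub>R (b - a)" for t by (simp add: algebra_simps)
  then show ?thesis using assms by (auto simp: in_segment)
qed

text \<open>Clearing the denominator of the crossing parameter leaves a polynomial sign condition
  that can be evaluated over the integers. The case \<open>p = q\<close> fits in because division by
  zero yields zero.\<close>

lemma closed_segment_meets_open_ray_iff:
  assumes "a \<noteq> b"
    and "orient a b u = 0 \<Longrightarrow> u = a \<or> u = b" "orient a b v = 0 \<Longrightarrow> v = a \<or> v = b"
    and "orient a b u \<noteq> 0 \<or> orient a b v \<noteq> 0"
  shows "closed_segment u v \<inter> open_ray_beyond a b \<noteq> {} \<longleftrightarrow>
    orient a b u * orient a b v < 0 \<and> 0 < orient u v b * (orient u v a - orient u v b)"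
proof -
  have *: "1 < p / (p - q) \<longleftrightarrow> 0 < q * (p - q)" for p q :: real
  proof (cases "p = q")
    case False
    then show ?thesis
      by (cases "p < q") (auto simp: divide_simps zero_less_mult_iff)
  qed auto
  show ?thesis unfolding open_ray_beyond_eq
    by (subst closed_segment_meets_line_part_iff)
      (use assms in \<open>simp_all only: greaterThan_iff greaterThanLessThan_iff * less_irrefl
         not_one_less_zero zero_less_one simp_thms\<close>)
qed

lemma closed_segment_meets_open_segment_iff:
  assumes "a \<noteq> b"
    and "orient a b u = 0 \<Longrightarrow> u = a \<or> u = b" "orient a b v = 0 \<Longrightarrow> v = a \<or> v = b"
    and "orient a b u \<noteq> 0 \<or> orient a b v \<noteq> 0"
  shows "closed_segment u v \<inter> open_segment a b \<noteq> {} \<longleftrightarrow>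
    orient a b u * orient a b v < 0 \<and> orient u v a * orient u v b < 0"
proof -
  have *: "0 < p / (p - q) \<and> p / (p - q) < 1 \<longleftrightarrow> p * q < 0" for p q :: real
  proof (cases "p = q")
    case False
    then show ?thesis
      by (cases "p < q") (auto simp: divide_simps mult_less_0_iff)
  qed (auto simp: mult_less_0_iff)
  show ?thesis unfolding open_segment_eq_line_part[OF assms(1)]
    by (subst closed_segment_meets_line_part_iff)
      (use assms in \<open>simp_all only: greaterThan_iff greaterThanLessThan_iff * less_irrefl
         not_one_less_zero zero_less_one simp_thms\<close>)
qed

subsection \<open>Polygonal paths and their winding numbers\<close>

lemma pathstart_polyline [simp]: "pathstart (polyline (a # vs)) = a"
  by (cases "a # vs" rule: polyline.cases) auto

lemma pathfinish_polyline: "vs \<noteq> [] \<Longrightarrow> pathfinish (polyline vs) = last vs"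
  by (induction vs rule: polyline.induct) auto

lemma valid_path_polyline: "valid_path (polyline vs)"
  by (induction vs rule: polyline.induct)
    (simp_all only: polyline.simps valid_path_linepath, auto intro!: valid_path_join)

lemma path_image_polyline_Cons:
  "path_image (polyline (a # b # vs)) = closed_segment a b \<union> path_image (polyline (b # vs))"
  by (cases vs) (auto simp: path_image_join)

lemma path_image_polyline_snoc:
  "path_image (polyline (a # vs @ [b])) =
    path_image (polyline (a # vs)) \<union> closed_segment (last (a # vs)) b"
proof (induction vs arbitrary: a)
  case (Cons c vs)
  then show ?case using Cons.IH[of c]
    by (simp only: append_Cons path_image_polyline_Cons last.simps) auto
qed (auto simp: path_image_join)

lemma path_image_polyline_nth:
  "path_image (polyline (a # b # vs)) =
    (\<Union>k<Suc (length vs). closed_segment ((a # b # vs) ! k) ((a # b # vs) ! Suc k))"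
proof (induction vs arbitrary: a b)
  case (Cons c vs)
  show ?case
    unfolding path_image_polyline_Cons[of a] Cons.IH[of b c] lessThan_Suc_eq_insert_0
    by (simp add: lessThan_Suc_eq_insert_0 image_image)
qed (simp add: lessThan_Suc)

lemma path_image_polygon_path:
  assumes "length P \<ge> 2"
  shows "path_image (polygon_path P) =
    (\<Union>k<length P. closed_segment (P ! k) (P ! next_vertex P k))"
proof -
  obtain a b vs where P: "P = a # b # vs"
    using assms by (cases P; cases "tl P") auto
  \<comment> \<open>The appended copy of the first vertex matches the wrap-around of
    \<open>next_vertex\<close> at the last index.\<close>
  have "(P @ [a]) ! Suc k = P ! next_vertex P k" if "k < length P" for k
    using that by (cases "k = Suc (length vs)")
      (simp_all add: next_vertex_def nth_append P flip: append_Cons)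
  moreover have "(P @ [a]) ! k = P ! k" if "k < length P" for k
    using that by (simp add: nth_append)
  ultimately show ?thesis
    using path_image_polyline_nth[of a b "vs @ [a]"] by (simp add: polygon_path_def P)
qed

text \<open>Counts +1 for an upward and -1 for a downward crossing of the horizontal ray to the
  right of \<open>z\<close>: the sign of the determinant tells on which side of \<open>z\<close> the
  edge passes.\<close>

definition signed_crossing :: "complex \<Rightarrow> complex \<Rightarrow> complex \<Rightarrow> int" where
  "signed_crossing z a b =
    (if Im a < Im z \<and> Im z < Im b \<and> orient a b z > 0 then 1
     else if Im b < Im z \<and> Im z < Im a \<and> orient a b z < 0 then -1 else 0)"

text \<open>On the segment, \<open>Ln (c * (w - z))\<close> is an antiderivative of
  \<open>1 / (w - z)\<close>. The sign \<open>c\<close> places the branch cut: to the left of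
  \<open>z\<close> for \<open>c = 1\<close>, to the right for \<open>c = -1\<close>.\<close>

lemma winding_number_linepath_Ln:
  assumes c: "c = 1 \<or> c = -1"
    and ray: "\<And>w. w \<in> closed_segment a b \<Longrightarrow> c * (w - z) \<notin> \<real>\<^sub>\<le>\<^sub>0"
  shows "winding_number (linepath a b) z = (Ln (c * (b - z)) - Ln (c * (a - z))) / (2 * pi * \<i>)"
proof -
  have "z \<notin> closed_segment a b"
    using ray[of z] by auto
  have "((\<lambda>w. Ln (c * (w - z))) has_field_derivative 1 / (w - z)) (at w within closed_segment a b)"
    if "w \<in> closed_segment a b" for w
  proof -
    have "w \<noteq> z" "c * (w - z) \<notin> \<real>\<^sub>\<le>\<^sub>0" using ray[OF that] by auto
    moreover have "inverse (c * (w - z)) * c = 1 / (w - z)"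
      using c by (cases "c = 1") (simp_all add: divide_simps)
    moreover have "((\<lambda>w. c * (w - z)) has_field_derivative c) (at w within closed_segment a b)"
      by (auto intro!: derivative_eq_intros)
    ultimately show ?thesis
      by (metis DERIV_chain2 has_field_derivative_Ln)
  qed
  then have "((\<lambda>w. 1 / (w - z)) has_contour_integral Ln (c * (b - z)) - Ln (c * (a - z)))
      (linepath a b)"
    using contour_integral_primitive[of "closed_segment a b" "\<lambda>w. Ln (c * (w - z))"
        "\<lambda>w. 1 / (w - z)" "linepath a b"] by simp
  then show ?thesis
    using winding_number_valid_path[of "linepath a b" z] \<open>z \<notin> closed_segment a b\<close>
    by (simp add: contour_integral_unique)
qed

text \<open>Reads off from the determinant and the vertical direction of the edge whether it passes
  to the right or to the left of \<open>z\<close>.\<close>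

lemma orient_at_same_height:
  assumes "w \<in> closed_segment a b" "Im w = Im z"
  shows "orient a b z = (Im b - Im a) * (Re w - Re z)"
proof -
  obtain s where "w = (1 - s) *\<^sub>R a + s *\<^sub>R b"
    using assms(1) by (auto simp: closed_segment_def)
  then have "orient a b w = 0"
    by (simp add: orient_affine)
  then show ?thesis using assms(2) by (simp add: orient_def algebra_simps)
qed

text \<open>With the branch cut of \<open>Ln (z - w)\<close> along the ray to the right of \<open>z\<close>, every crossing of
  that ray contributes \<open>\<plusminus>1\<close>.\<close>

lemma winding_number_linepath_signed_crossing:
  assumes "Im a \<noteq> Im z" "Im b \<noteq> Im z" "orient a b z \<noteq> 0"
  shows "winding_number (linepath a b) z =
    (Ln (z - b) - Ln (z - a)) / (2 * pi * \<i>) + of_int (signed_crossing z a b)"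
proof -
  have same_side: "Im w \<noteq> Im z"
    if "w \<in> closed_segment a b" "(Im a - Im z) * (Im b - Im z) > 0" for w
  proof -
    have "\<exists>s\<ge>0. s \<le> 1 \<and> w = (1 - s) *\<^sub>R a + s *\<^sub>R b"
      using that(1) by (simp only: in_segment)
    then obtain s where "0 \<le> s" "s \<le> 1" "Im w = Im ((1 - s) *\<^sub>R a + s *\<^sub>R b)"
      by blast
    then have "Im w - Im z = (1 - s) * (Im a - Im z) + s * (Im b - Im z)"
      by (simp add: algebra_simps)
    then show ?thesis
      using convex_comb_same_sign[OF that(2) \<open>0 \<le> s\<close> \<open>s \<le> 1\<close>] by linarith
  qed
  show ?thesis
  proof (cases "signed_crossing z a b = 0")
    case True
    \<comment> \<open>Without a crossing the segment avoids the ray to the right of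
      \<open>z\<close>, so the branch with \<open>c = -1\<close> gives the formula directly.\<close>
    have "-1 * (w - z) \<notin> \<real>\<^sub>\<le>\<^sub>0" if w: "w \<in> closed_segment a b" for w
    proof
      assume "-1 * (w - z) \<in> \<real>\<^sub>\<le>\<^sub>0"
      then have h: "Im w = Im z" "Re z \<le> Re w" by (auto simp: complex_nonpos_Reals_iff)
      then have "\<not> (Im a - Im z) * (Im b - Im z) > 0" using same_side[OF w] by blast
      then have "Im a < Im z \<and> Im z < Im b \<or> Im b < Im z \<and> Im z < Im a"
        using assms(1,2) unfolding zero_less_mult_iff by linarith
      then show False
      proof
        assume "Im a < Im z \<and> Im z < Im b"
        moreover from this have "orient a b z \<ge> 0"
          unfolding orient_at_same_height[OF w h(1)] using h(2) by (intro mult_nonneg_nonneg) auto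
        ultimately show False using True assms(3) by (simp add: signed_crossing_def)
      next
        assume "Im b < Im z \<and> Im z < Im a"
        moreover from this have "orient a b z \<le> 0"
          unfolding orient_at_same_height[OF w h(1)] using h(2) by (intro mult_nonpos_nonneg) auto
        ultimately show False using True assms(3) by (simp add: signed_crossing_def)
      qed
    qed
    then show ?thesis
      using winding_number_linepath_Ln[of "-1" a b z] True by simp
  next
    case False
    \<comment> \<open>A segment that crosses the right ray misses the left one, so the other branch
      of the logarithm applies.\<close>
    have "1 * (w - z) \<notin> \<real>\<^sub>\<le>\<^sub>0" if w: "w \<in> closed_segment a b" for w
    proof
      assume "1 * (w - z) \<in> \<real>\<^sub>\<le>\<^sub>0"
      then have h: "Im w = Im z" "Re w \<le> Re z" by (auto simp: complex_nonpos_Reals_iff)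
      from False consider "Im a < Im b" "orient a b z > 0" | "Im b < Im a" "orient a b z < 0"
        by (auto simp: signed_crossing_def split: if_splits)
      then show False
        unfolding orient_at_same_height[OF w h(1)] using h(2)
        by cases (simp_all add: zero_less_mult_iff mult_less_0_iff)
    qed
    then have wn: "winding_number (linepath a b) z = (Ln (b - z) - Ln (a - z)) / (2 * pi * \<i>)"
      using winding_number_linepath_Ln[of 1 a b z] by simp
    have nz: "a - z \<noteq> 0" "b - z \<noteq> 0" using assms by auto
    define k where "k = complex_of_real (2 * pi) * \<i>"
    have "k \<noteq> 0" by (simp add: k_def)
    \<comment> \<open>Passing from \<open>Ln (w - z)\<close> to \<open>Ln (z - w)\<close> shifts the
      values at \<open>a\<close> and \<open>b\<close> by \<pi>i with opposite signs; their
      difference changes by one full period \<open>k\<close>.\<close>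
    have period: "(x - y) / k = ((x - \<i> * pi) - (y + \<i> * pi)) / k + 1"
      "(x - y) / k = ((x + \<i> * pi) - (y - \<i> * pi)) / k - 1" for x y
    proof -
      have "(x - \<i> * pi) - (y + \<i> * pi) = (x - y) - k" "(x + \<i> * pi) - (y - \<i> * pi) = (x - y) + k"
        by (simp_all add: k_def algebra_simps)
      then show "(x - y) / k = ((x - \<i> * pi) - (y + \<i> * pi)) / k + 1"
        "(x - y) / k = ((x + \<i> * pi) - (y - \<i> * pi)) / k - 1"
        using \<open>k \<noteq> 0\<close> by (simp_all only: diff_divide_distrib add_divide_distrib divide_self) simp_all
    qed
    from False consider
      "Im a < Im z" "Im z < Im b" "signed_crossing z a b = 1" |
      "Im b < Im z" "Im z < Im a" "signed_crossing z a b = -1"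
      by (auto simp: signed_crossing_def split: if_splits)
    then show ?thesis
    proof cases
      case 1
      then have "Ln (z - b) = Ln (b - z) - \<i> * pi" "Ln (z - a) = Ln (a - z) + \<i> * pi"
        using Ln_minus[OF nz(1)] Ln_minus[OF nz(2)] by simp_all
      then show ?thesis unfolding wn 1(3) k_def[symmetric] period(1)[of "Ln (b - z)"] by simp
    next
      case 2
      then have "Ln (z - b) = Ln (b - z) + \<i> * pi" "Ln (z - a) = Ln (a - z) - \<i> * pi"
        using Ln_minus[OF nz(1)] Ln_minus[OF nz(2)] by simp_all
      then show ?thesis unfolding wn 2(3) k_def[symmetric] period(2)[of "Ln (b - z)"] by simp
    qed
  qed
qed

fun crossing_sum :: "complex \<Rightarrow> complex list \<Rightarrow> int" where
  "crossing_sum z (a # b # vs) = signed_crossing z a b + crossing_sum z (b # vs)"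
| "crossing_sum z _ = 0"

text \<open>More than \<open>z\<close> lying off the chain: no vertex of an edge has the height of
  \<open>z\<close>, so the horizontal ray passes through no vertex and every crossing is counted
  unambiguously.\<close>

fun off_edges :: "complex \<Rightarrow> complex list \<Rightarrow> bool" where
  "off_edges z (a # b # vs) \<longleftrightarrow>
    Im a \<noteq> Im z \<and> Im b \<noteq> Im z \<and> orient a b z \<noteq> 0 \<and> off_edges z (b # vs)"
| "off_edges z _ \<longleftrightarrow> True"

lemma orient_neq_0_notin_closed_segment:
  assumes "orient a b z \<noteq> 0"
  shows "z \<notin> closed_segment a b"
  using orient_at_same_height[of z a b z] assms by auto

lemma off_edges_notin_path_image:
  "off_edges z (a # b # vs) \<Longrightarrow> z \<notin> path_image (polyline (a # b # vs))"
proof (induction vs arbitrary: a b)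
  case Nil
  then show ?case by (auto dest: orient_neq_0_notin_closed_segment)
next
  case (Cons c vs)
  then show ?case unfolding path_image_polyline_Cons[of a]
    by (auto dest: orient_neq_0_notin_closed_segment)
qed

text \<open>The logarithms telescope along the chain, leaving those of its two ends; they cancel
  when the chain is closed.\<close>

lemma winding_number_polyline:
  assumes "off_edges z (a # b # vs)"
  shows "winding_number (polyline (a # b # vs)) z =
    (Ln (z - last (b # vs)) - Ln (z - a)) / (2 * pi * \<i>) + of_int (crossing_sum z (a # b # vs))"
  using assms
proof (induction vs arbitrary: a b)
  case Nil
  then show ?case by (simp add: winding_number_linepath_signed_crossing)
next
  case (Cons c vs)
  have "winding_number (polyline (a # b # c # vs)) z =
      winding_number (linepath a b) z + winding_number (polyline (b # c # vs)) z"
    unfolding polyline.simps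
  proof (rule winding_number_join)
    show "z \<notin> path_image (polyline (b # c # vs))"
      using Cons.prems by (intro off_edges_notin_path_image) simp
    show "z \<notin> path_image (linepath a b)"
      using Cons.prems orient_neq_0_notin_closed_segment by simp
  qed (auto simp: valid_path_polyline valid_path_imp_path)
  then show ?case
    using Cons.IH[of b c] Cons.prems
    by (simp add: winding_number_linepath_signed_crossing diff_divide_distrib)
qed

lemma winding_number_polygon_path:
  assumes "length P \<ge> 2" "off_edges z (P @ [hd P])"
  shows "winding_number (polygon_path P) z = of_int (crossing_sum z (P @ [hd P]))"
    and "z \<notin> path_image (polygon_path P)"
proof -
  obtain a b vs where P: "P = a # b # vs"
    using assms(1) by (cases P; cases "tl P") auto
  show "winding_number (polygon_path P) z = of_int (crossing_sum z (P @ [hd P]))"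
    using winding_number_polyline[of z a b "vs @ [a]"] assms(2)
    by (simp add: P polygon_path_def)
  show "z \<notin> path_image (polygon_path P)"
    using off_edges_notin_path_image[of z a b "vs @ [a]"] assms(2)
    by (simp add: P polygon_path_def)
qed

subsection \<open>Simple polygons with integer vertices\<close>

text \<open>Vertices are kept as integer pairs so that all sign conditions can be evaluated
  exactly.\<close>

fun pt :: "int \<times> int \<Rightarrow> complex" where
  "pt (x, y) = Complex (of_int x) (of_int y)"

fun int_orient :: "int \<times> int \<Rightarrow> int \<times> int \<Rightarrow> int \<times> int \<Rightarrow> int" where
  "int_orient (ax, ay) (bx, by) (cx, cy) = (bx - ax) * (cy - ay) - (by - ay) * (cx - ax)"

lemma orient_pt: "orient (pt a) (pt b) (pt c) = of_int (int_orient a b c)"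
  by (cases a; cases b; cases c) (simp add: orient_def)

lemma int_orient_self [simp]: "int_orient a a b = 0" "int_orient a b a = 0" "int_orient a b b = 0"
  by (cases a; cases b; simp)+

lemma pt_eq_iff [simp]: "pt a = pt b \<longleftrightarrow> a = b"
  by (cases a; cases b) (simp add: complex_eq_iff)

lemma Im_pt [simp]: "Im (pt a) = of_int (snd a)"
  by (cases a) simp

section \<open>Integer certificates for simplicity\<close>

definition segments_apart :: "int \<times> int \<Rightarrow> int \<times> int \<Rightarrow> int \<times> int \<Rightarrow> int \<times> int \<Rightarrow> bool" where
  "segments_apart a b c d \<longleftrightarrow>
    int_orient a b c * int_orient a b d > 0 \<or> int_orient c d a * int_orient c d b > 0"

lemma segments_apart_disjoint:
  assumes "segments_apart a b c d"
  shows "closed_segment (pt a) (pt b) \<inter> closed_segment (pt c) (pt d) = {}"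
  using assms
  by (intro closed_segment_disjoint_orient)
    (simp add: segments_apart_def orient_pt flip: of_int_mult)

fun avoids_chain :: "int \<times> int \<Rightarrow> int \<times> int \<Rightarrow> (int \<times> int) list \<Rightarrow> bool" where
  "avoids_chain a b (c # d # vs) \<longleftrightarrow> segments_apart a b c d \<and> avoids_chain a b (d # vs)"
| "avoids_chain a b _ \<longleftrightarrow> True"

lemma avoids_chain_disjoint:
  "avoids_chain a b (c # d # vs) \<Longrightarrow>
    closed_segment (pt a) (pt b) \<inter> path_image (polyline (map pt (c # d # vs))) = {}"
proof (induction vs arbitrary: c d)
  case Nil
  then show ?case using segments_apart_disjoint[of a b c d] by simp
next
  case (Cons e vs)
  then have "closed_segment (pt a) (pt b) \<inter> closed_segment (pt c) (pt d) = {}"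
    "closed_segment (pt a) (pt b) \<inter> path_image (polyline (map pt (d # e # vs))) = {}"
    using segments_apart_disjoint[of a b c d] by auto
  then show ?case
    unfolding list.map path_image_polyline_Cons[of "pt c"] Int_Un_distrib by simp
qed

lemma avoids_chain_adjacent:
  assumes "int_orient a b c \<noteq> 0" "avoids_chain a b (c # vs)"
  shows "closed_segment (pt a) (pt b) \<inter> path_image (polyline (map pt (b # c # vs))) = {pt b}"
proof -
  have "closed_segment (pt a) (pt b) \<inter> closed_segment (pt b) (pt c) = {pt b}"
    using assms(1) by (intro closed_segment_Int_adjacent) (simp add: orient_pt)
  \<comment> \<open>Inclusion rather than disjointness: for empty \<open>vs\<close> the remaining
    path is constant at \<open>c\<close>, about which \<open>avoids_chain\<close> says
    nothing.\<close>
  moreover have "closed_segment (pt a) (pt b) \<inter> path_image (polyline (map pt (c # vs))) \<subseteq>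
      closed_segment (pt b) (pt c)"
  proof (cases vs)
    case (Cons d ws)
    then show ?thesis using avoids_chain_disjoint[of a b c d ws] assms(2) by auto
  qed auto
  ultimately show ?thesis unfolding list.map path_image_polyline_Cons by auto
qed

fun embedded_chain :: "(int \<times> int) list \<Rightarrow> bool" where
  "embedded_chain (a # b # c # vs) \<longleftrightarrow>
    int_orient a b c \<noteq> 0 \<and> avoids_chain a b (c # vs) \<and> embedded_chain (b # c # vs)"
| "embedded_chain [a, b] \<longleftrightarrow> a \<noteq> b"
| "embedded_chain _ \<longleftrightarrow> False"

text \<open>Edges are prepended one at a time; each meets the rest of the chain only in the vertex
  where they are joined.\<close>

lemma arc_polyline: "embedded_chain vs \<Longrightarrow> arc (polyline (map pt vs))"
proof (induction vs rule: embedded_chain.induct)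
  case (1 a b c vs)
  have "arc (linepath (pt a) (pt b) +++ polyline (map pt (b # c # vs)))"
  proof (rule arc_join)
    show "arc (linepath (pt a) (pt b))"
      using 1(2) by (intro arc_linepath) auto
    show "path_image (linepath (pt a) (pt b)) \<inter> path_image (polyline (map pt (b # c # vs)))
        \<subseteq> {pathstart (polyline (map pt (b # c # vs)))}"
      using avoids_chain_adjacent[of a b c vs] 1(2) by simp
  qed (use 1 in auto)
  then show ?case by simp
qed auto

text \<open>The boundary is split into the edge \<open>a b\<close> and an arc from \<open>b\<close>
  back to \<open>a\<close>, which may share only their ends. The closing edge touches
  \<open>a b\<close> at \<open>a\<close>, so it is left out of \<open>avoids_chain\<close> and
  handled by the determinant at \<open>last (c # vs)\<close>.\<close>

fun embedded_polygon :: "(int \<times> int) list \<Rightarrow> bool" where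
  "embedded_polygon (a # b # c # vs) \<longleftrightarrow>
    int_orient a b c \<noteq> 0 \<and> int_orient (last (c # vs)) a b \<noteq> 0 \<and>
    avoids_chain a b (c # vs) \<and> embedded_chain (b # c # vs @ [a])"
| "embedded_polygon _ \<longleftrightarrow> False"

lemma simple_path_polygon_path:
  assumes "embedded_polygon vs"
  shows "simple_path (polygon_path (map pt vs))"
proof -
  obtain a b c ws where vs: "vs = a # b # c # ws"
    using assms by (cases vs rule: embedded_polygon.cases) auto
  note * = assms[unfolded vs embedded_polygon.simps]
  let ?rest = "map pt (b # c # ws @ [a])"
  have image: "path_image (polyline ?rest) = path_image (polyline (map pt (b # c # ws))) \<union>
      closed_segment (pt (last (c # ws))) (pt a)"
    using path_image_polyline_snoc[of "pt b" "map pt (c # ws)" "pt a"]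
    by (simp del: polyline.simps add: last_map)
  have "closed_segment (pt (last (c # ws))) (pt a) \<inter> closed_segment (pt a) (pt b) = {pt a}"
    using * by (intro closed_segment_Int_adjacent) (simp add: orient_pt)
  moreover have "closed_segment (pt a) (pt b) \<inter> path_image (polyline (map pt (b # c # ws))) = {pt b}"
    using avoids_chain_adjacent[of a b c ws] * by blast
  ultimately have "closed_segment (pt a) (pt b) \<inter> path_image (polyline ?rest) \<subseteq> {pt a, pt b}"
    unfolding image by blast
  moreover have "pt a \<noteq> pt b" using * by auto
  moreover have "arc (polyline ?rest)"
    using arc_polyline[of "b # c # ws @ [a]"] * by blast
  moreover have "pathfinish (polyline ?rest) = pt a" "pathstart (polyline ?rest) = pt b"
    by (simp_all only: list.map pathstart_polyline) (simp add: pathfinish_polyline del: polyline.simps)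
  ultimately have "simple_path (linepath (pt a) (pt b) +++ polyline ?rest)"
    by (intro simple_path_join_loop arc_linepath) simp_all
  then show ?thesis by (simp add: vs polygon_path_def)
qed


subsection \<open>Stabbing information of integer polygons\<close>

definition no_three_collinear :: "(int \<times> int) list \<Rightarrow> bool" where
  "no_three_collinear vs \<longleftrightarrow> distinct vs \<and>
    list_all (\<lambda>a. list_all (\<lambda>b. a = b \<or>
      list_all (\<lambda>c. c = a \<or> c = b \<or> int_orient a b c \<noteq> 0) vs) vs) vs"

lemma no_three_collinearD:
  assumes "no_three_collinear vs" "a \<in> set vs" "b \<in> set vs" "c \<in> set vs" "a \<noteq> b"
    "int_orient a b c = 0"
  shows "c = a \<or> c = b"
  using assms unfolding no_three_collinear_def list_all_iff by blast

lemma general_position_map_pt: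
  assumes "no_three_collinear vs"
  shows "general_position (map pt vs)"
  unfolding general_position_def
proof (intro allI impI notI, elim conjE)
  fix i j k
  assume *: "i < length (map pt vs)" "j < length (map pt vs)" "k < length (map pt vs)"
    "i \<noteq> j" "j \<noteq> k" "i \<noteq> k" "collinear {map pt vs ! i, map pt vs ! j, map pt vs ! k}"
  have "vs ! i \<noteq> vs ! j" "vs ! k \<noteq> vs ! i" "vs ! k \<noteq> vs ! j"
    using * assms by (auto simp: no_three_collinear_def nth_eq_iff_index_eq)
  moreover have "int_orient (vs ! i) (vs ! j) (vs ! k) = 0"
    using collinear_imp_orient_eq_0[OF *(7)] * by (simp add: orient_pt)
  ultimately show False
    using no_three_collinearD[OF assms] * by (metis length_map nth_mem)
qed

definition polygon_edges :: "(int \<times> int) list \<Rightarrow> ((int \<times> int) \<times> (int \<times> int)) list" where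
  "polygon_edges vs = zip vs (rotate1 vs)"

fun crosses_ray :: "int \<times> int \<Rightarrow> int \<times> int \<Rightarrow> (int \<times> int) \<times> (int \<times> int) \<Rightarrow> bool" where
  "crosses_ray a b (u, v) \<longleftrightarrow> int_orient a b u * int_orient a b v < 0 \<and>
    (let p = int_orient u v a; q = int_orient u v b in 0 < q * (p - q))"

fun crosses_segment :: "int \<times> int \<Rightarrow> int \<times> int \<Rightarrow> (int \<times> int) \<times> (int \<times> int) \<Rightarrow> bool" where
  "crosses_segment a b (u, v) \<longleftrightarrow> int_orient a b u * int_orient a b v < 0 \<and>
    int_orient u v a * int_orient u v b < 0"

text \<open>Common to heads and bodies: \<open>R\<close> is the part of the line and
  \<open>f\<close> the integer test for it. By \<open>f0\<close> the test rejects an edge joining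
  \<open>i\<close> and \<open>j\<close>, so the exclusion of that edge in \<open>crossings\<close>
  is built into \<open>f\<close>.\<close>

lemma crossings_map_pt:
  assumes "no_three_collinear vs" "i < length vs" "j < length vs" "i \<noteq> j"
    and f: "\<And>u v. u \<in> set vs \<Longrightarrow> v \<in> set vs \<Longrightarrow>
      \<not> (int_orient (vs ! i) (vs ! j) u = 0 \<and> int_orient (vs ! i) (vs ! j) v = 0) \<Longrightarrow>
      closed_segment (pt u) (pt v) \<inter> R \<noteq> {} \<longleftrightarrow> f (u, v)"
    and f0: "\<And>u v. f (u, v) \<Longrightarrow>
      \<not> (int_orient (vs ! i) (vs ! j) u = 0 \<and> int_orient (vs ! i) (vs ! j) v = 0)"
  shows "crossings (map pt vs) i j R = length (filter f (polygon_edges vs))"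
proof -
  let ?n = "length vs"
  have dist: "distinct vs" using assms by (simp add: no_three_collinear_def)
  have len: "length (polygon_edges vs) = ?n" by (simp add: polygon_edges_def)
  have pos: "0 < ?n" using assms(2) by linarith
  have next_less: "next_vertex (map pt vs) k < ?n" "next_vertex (map pt vs) k = Suc k mod ?n" for k
    using mod_less_divisor[OF pos, of "Suc k"] by (simp_all add: next_vertex_def)
  have next_neq: "next_vertex (map pt vs) k \<noteq> k" if "k < ?n" for k
    using that assms(2-4) unfolding next_less(2) by (cases "Suc k = ?n") auto
  have "{k, next_vertex (map pt vs) k} \<noteq> {i, j} \<and>
      closed_segment (map pt vs ! k) (map pt vs ! next_vertex (map pt vs) k) \<inter> R \<noteq> {} \<longleftrightarrow>
      f (polygon_edges vs ! k)" if k: "k < ?n" for k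
  proof -
    let ?l = "next_vertex (map pt vs) k"
    have edge: "polygon_edges vs ! k = (vs ! k, vs ! ?l)"
      using k by (simp add: polygon_edges_def nth_rotate1 next_less(2))
    have "int_orient (vs ! i) (vs ! j) (vs ! m) = 0 \<longleftrightarrow> m = i \<or> m = j" if "m < ?n" for m
    proof
      assume "int_orient (vs ! i) (vs ! j) (vs ! m) = 0"
      then have "vs ! m = vs ! i \<or> vs ! m = vs ! j"
        using no_three_collinearD[OF assms(1), of "vs ! i" "vs ! j" "vs ! m"] that assms(2-4) dist
        by (simp add: nth_eq_iff_index_eq)
      then show "m = i \<or> m = j"
        using that assms(2-3) dist by (simp add: nth_eq_iff_index_eq)
    qed auto
    \<comment> \<open>By general position only \<open>i\<close> and \<open>j\<close> lie on the
      line, so an edge with both ends on it is the pair itself.\<close>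
    then have line: "int_orient (vs ! i) (vs ! j) (vs ! k) = 0 \<and>
        int_orient (vs ! i) (vs ! j) (vs ! ?l) = 0 \<longleftrightarrow> {k, ?l} = {i, j}"
      using k next_less(1) next_neq[OF k] by (auto simp: doubleton_eq_iff)
    show ?thesis
    proof (cases "{k, ?l} = {i, j}")
      case True
      then show ?thesis using f0[of "vs ! k" "vs ! ?l"] line unfolding edge by blast
    next
      case False
      then show ?thesis
        using f[of "vs ! k" "vs ! ?l"] line k next_less(1) unfolding edge by simp
    qed
  qed
  then have "{k. k < ?n \<and> {k, next_vertex (map pt vs) k} \<noteq> {i, j} \<and>
      closed_segment (map pt vs ! k) (map pt vs ! next_vertex (map pt vs) k) \<inter> R \<noteq> {}} =
      {k. k < length (polygon_edges vs) \<and> f (polygon_edges vs ! k)}"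
    unfolding len by (intro Collect_cong conj_cong refl)
  then show ?thesis by (simp add: crossings_def length_filter_conv_card)
qed

lemma
  assumes "no_three_collinear vs" "i < length vs" "j < length vs" "i \<noteq> j"
  shows Head_map_pt: "Head (map pt vs) i j =
      length (filter (crosses_ray (vs ! i) (vs ! j)) (polygon_edges vs))" (is ?H)
    and Body_map_pt: "Body (map pt vs) i j =
      length (filter (crosses_segment (vs ! i) (vs ! j)) (polygon_edges vs))" (is ?B)
proof -
  have ij: "vs ! i \<noteq> vs ! j" "vs ! i \<in> set vs" "vs ! j \<in> set vs"
    using assms by (auto simp: no_three_collinear_def nth_eq_iff_index_eq)
  have gp: "pt u = pt (vs ! i) \<or> pt u = pt (vs ! j)"
    if "u \<in> set vs" "orient (pt (vs ! i)) (pt (vs ! j)) (pt u) = 0" for u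
    using no_three_collinearD[OF assms(1) ij(2,3) that(1) ij(1)] that(2) by (simp add: orient_pt)
  show ?H
    unfolding Head_def
  proof (rule crossings_map_pt[OF assms])
    fix u v assume uv: "u \<in> set vs" "v \<in> set vs"
      "\<not> (int_orient (vs ! i) (vs ! j) u = 0 \<and> int_orient (vs ! i) (vs ! j) v = 0)"
    have "closed_segment (pt u) (pt v) \<inter> open_ray_beyond (pt (vs ! i)) (pt (vs ! j)) \<noteq> {} \<longleftrightarrow>
        orient (pt (vs ! i)) (pt (vs ! j)) (pt u) * orient (pt (vs ! i)) (pt (vs ! j)) (pt v) < 0 \<and>
        0 < orient (pt u) (pt v) (pt (vs ! j)) *
          (orient (pt u) (pt v) (pt (vs ! i)) - orient (pt u) (pt v) (pt (vs ! j)))"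
      by (rule closed_segment_meets_open_ray_iff) (use ij gp uv in \<open>simp_all add: orient_pt\<close>)
    also have "\<dots> \<longleftrightarrow> crosses_ray (vs ! i) (vs ! j) (u, v)"
      unfolding orient_pt of_int_mult[symmetric] of_int_diff[symmetric] of_int_less_0_iff
        of_int_0_less_iff crosses_ray.simps Let_def ..
    finally show "closed_segment (pt u) (pt v) \<inter> open_ray_beyond (map pt vs ! i) (map pt vs ! j) \<noteq> {}
        \<longleftrightarrow> crosses_ray (vs ! i) (vs ! j) (u, v)"
      using assms(2,3) by simp
  qed auto
  show ?B
    unfolding Body_def
  proof (rule crossings_map_pt[OF assms])
    fix u v assume uv: "u \<in> set vs" "v \<in> set vs"
      "\<not> (int_orient (vs ! i) (vs ! j) u = 0 \<and> int_orient (vs ! i) (vs ! j) v = 0)"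
    have "closed_segment (pt u) (pt v) \<inter> open_segment (pt (vs ! i)) (pt (vs ! j)) \<noteq> {} \<longleftrightarrow>
        orient (pt (vs ! i)) (pt (vs ! j)) (pt u) * orient (pt (vs ! i)) (pt (vs ! j)) (pt v) < 0 \<and>
        orient (pt u) (pt v) (pt (vs ! i)) * orient (pt u) (pt v) (pt (vs ! j)) < 0"
      by (rule closed_segment_meets_open_segment_iff) (use ij gp uv in \<open>simp_all add: orient_pt\<close>)
    also have "\<dots> \<longleftrightarrow> crosses_segment (vs ! i) (vs ! j) (u, v)"
      unfolding orient_pt of_int_mult[symmetric] of_int_diff[symmetric] of_int_less_0_iff
        of_int_0_less_iff crosses_segment.simps Let_def ..
    finally show "closed_segment (pt u) (pt v) \<inter> open_segment (map pt vs ! i) (map pt vs ! j) \<noteq> {}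
        \<longleftrightarrow> crosses_segment (vs ! i) (vs ! j) (u, v)"
      using assms(2,3) by simp
  qed auto
qed

lemma Tail_eq_Head: "Tail P i j = Head P j i"
  by (simp add: Tail_def Head_def crossings_def insert_commute)

text \<open>The tail is computed as the head of the reversed pair, whence
  \<open>crosses_ray b a\<close> in the first component.\<close>

definition zp_entry ::
  "(int \<times> int) list \<Rightarrow> int \<times> int \<Rightarrow> int \<times> int \<Rightarrow> zero_parity \<times> zero_parity \<times> zero_parity" where
  "zp_entry vs a b = (let es = polygon_edges vs in
    (zero_parity_of (length (filter (crosses_ray b a) es)),
     zero_parity_of (length (filter (crosses_segment a b) es)),
     zero_parity_of (length (filter (crosses_ray a b) es))))"

text \<open>Diagonal entries are included only to keep the indexing by labels; for
  \<open>a = b\<close> all determinants vanish and every count is zero.\<close>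

definition zp_table ::
  "(int \<times> int) list \<Rightarrow> (zero_parity \<times> zero_parity \<times> zero_parity) list list" where
  "zp_table vs = map (\<lambda>a. map (zp_entry vs a) vs) vs"

lemma zp_stabbing_info_map_pt:
  assumes "no_three_collinear vs"
  shows "zp_stabbing_info (map pt vs) = (\<lambda>(i, j).
    if i < length vs \<and> j < length vs \<and> i \<noteq> j then Some (zp_table vs ! i ! j) else None)"
  using assms
  by (auto simp: zp_stabbing_info_def fun_eq_iff zp_table_def zp_entry_def Let_def Tail_eq_Head
      Head_map_pt Body_map_pt)


subsection \<open>Winding numbers and sides of diagonals\<close>

fun int_signed_crossing :: "int \<times> int \<Rightarrow> int \<times> int \<Rightarrow> int \<times> int \<Rightarrow> int" where
  "int_signed_crossing z a b =
    (if snd a < snd z \<and> snd z < snd b \<and> int_orient a b z > 0 then 1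
     else if snd b < snd z \<and> snd z < snd a \<and> int_orient a b z < 0 then -1 else 0)"

definition int_crossing_sum :: "int \<times> int \<Rightarrow> (int \<times> int) list \<Rightarrow> int" where
  "int_crossing_sum z vs = (\<Sum>(a, b)\<leftarrow>polygon_edges vs. int_signed_crossing z a b)"

definition int_off_edges :: "int \<times> int \<Rightarrow> (int \<times> int) list \<Rightarrow> bool" where
  "int_off_edges z vs \<longleftrightarrow> list_all (\<lambda>a. snd a \<noteq> snd z) vs \<and>
    list_all (\<lambda>(a, b). int_orient a b z \<noteq> 0) (polygon_edges vs)"

lemma winding_number_map_pt:
  assumes "length vs \<ge> 2" "int_off_edges z vs"
  shows "winding_number (polygon_path (map pt vs)) (pt z) = of_int (int_crossing_sum z vs)"
    and "pt z \<notin> path_image (polygon_path (map pt vs))"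
proof -
  have sum: "crossing_sum (pt z) (map pt (a # ws)) =
      (\<Sum>(a, b)\<leftarrow>zip (a # ws) ws. int_signed_crossing z a b)" for a ws
    by (induction ws arbitrary: a) (simp_all add: signed_crossing_def orient_pt)
  have off: "off_edges (pt z) (map pt (a # ws)) \<longleftrightarrow> ws = [] \<or>
      list_all (\<lambda>a. snd a \<noteq> snd z) (a # ws) \<and>
      list_all (\<lambda>(a, b). int_orient a b z \<noteq> 0) (zip (a # ws) ws)" for a ws
    by (induction ws arbitrary: a) (auto simp: orient_pt)
  obtain a ws where vs: "vs = a # ws" using assms(1) by (cases vs) auto
  \<comment> \<open>Pairing the closed chain with its own tail lists the cyclic edges;
    \<open>zip\<close> drops the surplus final vertex.\<close>
  have edges: "polygon_edges vs = zip (a # ws @ [a]) (ws @ [a])"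
    unfolding vs polygon_edges_def rotate1.simps
    using zip_append1[of "a # ws" "[a]" "ws @ [a]"] by simp
  have "off_edges (pt z) (map pt vs @ [hd (map pt vs)])"
    using off[of a "ws @ [a]"] assms(2) edges by (simp add: vs int_off_edges_def)
  moreover have "crossing_sum (pt z) (map pt vs @ [hd (map pt vs)]) = int_crossing_sum z vs"
    using sum[of a "ws @ [a]"] edges by (simp add: vs int_crossing_sum_def)
  ultimately show "winding_number (polygon_path (map pt vs)) (pt z) = of_int (int_crossing_sum z vs)"
    and "pt z \<notin> path_image (polygon_path (map pt vs))"
    using winding_number_polygon_path[of "map pt vs" "pt z"] assms(1) by simp_all
qed

section \<open>Interior, exterior and orientation from winding numbers\<close>

lemma closed_polygon_path:
  "P \<noteq> [] \<Longrightarrow> pathfinish (polygon_path P) = pathstart (polygon_path P)"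
  by (cases P) (simp_all add: polygon_path_def pathfinish_polyline)

text \<open>A simple closed curve has winding number 1 or -1 around inside points and 0 around
  outside points, and these two sets cover the complement of the curve.\<close>

lemma polygon_interior_exterior_iff_winding_number:
  assumes "simple_polygon P" "z \<notin> path_image (polygon_path P)"
  shows "z \<in> polygon_interior P \<longleftrightarrow> winding_number (polygon_path P) z \<noteq> 0"
    and "z \<in> polygon_exterior P \<longleftrightarrow> winding_number (polygon_path P) z = 0"
proof -
  have simple: "simple_path (polygon_path P)" and "P \<noteq> []"
    using assms(1) by (auto simp: simple_polygon_def)
  have "winding_number (polygon_path P) z \<noteq> 0" if "z \<in> polygon_interior P"
    using simple_closed_path_winding_number_inside[OF simple] that unfolding polygon_interior_def
    by (metis zero_neq_one zero_neq_neg_one)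
  moreover have "winding_number (polygon_path P) z = 0" if "z \<in> polygon_exterior P"
    using winding_number_zero_in_outside[OF simple_path_imp_path[OF simple]
        closed_polygon_path[OF \<open>P \<noteq> []\<close>]] that
    by (simp add: polygon_exterior_def)
  moreover have "z \<in> polygon_interior P \<union> polygon_exterior P"
    using assms(2) by (simp add: polygon_interior_def polygon_exterior_def inside_Un_outside)
  ultimately show "z \<in> polygon_interior P \<longleftrightarrow> winding_number (polygon_path P) z \<noteq> 0"
    and "z \<in> polygon_exterior P \<longleftrightarrow> winding_number (polygon_path P) z = 0"
    by blast+
qed

text \<open>The winding number is either 1 on the whole interior or -1 on the whole interior, so a
  single point decides the orientation.\<close>

lemma counterclockwise_if_winding_number:
  assumes "simple_polygon P" "z \<notin> path_image (polygon_path P)"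
    "winding_number (polygon_path P) z = 1"
  shows "counterclockwise P"
proof -
  have simple: "simple_path (polygon_path P)"
    using assms(1) by (simp add: simple_polygon_def)
  have "z \<in> polygon_interior P"
    using polygon_interior_exterior_iff_winding_number(1)[OF assms(1,2)] assms(3) by simp
  then show ?thesis
    using simple_closed_path_winding_number_inside[OF simple] assms(3)
    unfolding polygon_interior_def counterclockwise_def
    by (metis one_neq_neg_one)
qed

lemma admissible_polygon_map_pt:
  assumes "embedded_polygon vs" "no_three_collinear vs" "int_off_edges z vs"
    "int_crossing_sum z vs = 1"
  shows "admissible_polygon (map pt vs)"
proof -
  have "length vs \<ge> 3"
    using assms(1) by (cases vs rule: embedded_polygon.cases) auto
  then have "simple_polygon (map pt vs)"
    using simple_path_polygon_path[OF assms(1)] by (simp add: simple_polygon_def)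
  moreover from this have "counterclockwise (map pt vs)"
    using winding_number_map_pt[of vs z] assms(3,4) \<open>length vs \<ge> 3\<close>
    by (intro counterclockwise_if_winding_number[of _ "pt z"]) auto
  ultimately show ?thesis
    using general_position_map_pt[OF assms(2)] by (simp add: admissible_polygon_def)
qed

text \<open>The count in \<open>Body\<close> ignores only an edge joining \<open>i\<close> and
  \<open>j\<close>; for nonadjacent vertices there is none, so a zero count concerns the whole
  boundary.\<close>

lemma visibility_edge_disjoint:
  assumes "length P \<ge> 2" "visibility_edge P i j" "\<not> adjacent_vertices P i j"
  shows "open_segment (P ! i) (P ! j) \<inter> path_image (polygon_path P) = {}"
proof -
  have "{k. k < length P \<and> {k, next_vertex P k} \<noteq> {i, j} \<and>
      closed_segment (P ! k) (P ! next_vertex P k) \<inter> open_segment (P ! i) (P ! j) \<noteq> {}} = {}"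
    using assms(2) unfolding visibility_edge_def Body_def crossings_def by simp
  moreover have "{k, next_vertex P k} \<noteq> {i, j}" for k
    using assms(3) by (auto simp: adjacent_vertices_def doubleton_eq_iff)
  ultimately show ?thesis
    unfolding path_image_polygon_path[OF assms(1)] by blast
qed

lemma visibility_edge_side:
  assumes "simple_polygon P" "visibility_edge P i j" "\<not> adjacent_vertices P i j"
    and z: "z \<in> open_segment (P ! i) (P ! j)"
  shows "winding_number (polygon_path P) z \<noteq> 0 \<Longrightarrow> I_edge P i j"
    and "winding_number (polygon_path P) z = 0 \<Longrightarrow> E_edge P i j"
proof -
  have disjoint: "open_segment (P ! i) (P ! j) \<inter> path_image (polygon_path P) = {}"
    using assms by (intro visibility_edge_disjoint) (auto simp: simple_polygon_def)
  then have "z \<notin> path_image (polygon_path P)" using z by blast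
  note side = polygon_interior_exterior_iff_winding_number[OF assms(1) this]
  have conn: "connected_component (- path_image (polygon_path P)) z x"
    if "x \<in> open_segment (P ! i) (P ! j)" for x
    unfolding connected_component_def
    using that z disjoint
    by (intro exI[of _ "open_segment (P ! i) (P ! j)"]) (auto intro: convex_connected)
  show "I_edge P i j" if "winding_number (polygon_path P) z \<noteq> 0"
    using that side(1) assms(2,3) inside_same_component[OF conn]
    by (auto simp: I_edge_def polygon_interior_def)
  show "E_edge P i j" if "winding_number (polygon_path P) z = 0"
    using that side(2) assms(2,3) outside_same_component[OF conn]
    by (auto simp: E_edge_def polygon_exterior_def)
qed

subsection \<open>The two polygons\<close>

text \<open>
  These lists were found by a computer search. In both polygons the convex hull is the triangle
  9, 10, 11, and 0 and 8 are reflex. The chain 1, ..., 7 lies in the mouth between the arms 0 11 and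
  8 9, outside the pentagon 8, 9, 10, 11, 0, for \<open>I_list\<close>, and inside this pentagon for \<open>E_list\<close>.
  All coordinates are even, so that the midpoint of the diagonal 0 8 has integer coordinates; its
  height differs from the heights of all vertices.
\<close>

definition I_list :: "(int \<times> int) list" where
  "I_list = [(74,6), (70,50), (74,22), (76,40), (72,46), (72,50), (68,56), (70,46),
    (64,72), (86,96), (4,16), (104,0)]"

definition E_list :: "(int \<times> int) list" where
  "E_list = [(8,16), (24,20), (10,16), (14,14), (18,18), (26,12), (26,18), (18,28),
    (36,6), (40,0), (16,38), (2,0)]"

lemma length_lists: "length I_list = 12" "length E_list = 12"
  by (simp_all add: I_list_def E_list_def)

lemma no_three_collinear_lists: "no_three_collinear I_list" "no_three_collinear E_list"
  by code_simp+

lemma admissible_lists: "admissible_polygon (map pt I_list)" "admissible_polygon (map pt E_list)"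
proof -
  \<comment> \<open>The point (69, 39) is the midpoint of the diagonal 0 8, which is internal
    here.\<close>
  have "embedded_polygon I_list" "int_off_edges (69, 39) I_list" "int_crossing_sum (69, 39) I_list = 1"
    by code_simp+
  then show "admissible_polygon (map pt I_list)"
    using admissible_polygon_map_pt no_three_collinear_lists(1) by blast
  \<comment> \<open>Here that diagonal is external, so another interior point is taken: just below
    the top vertex 10, at a height reached only by the two edges at that vertex.\<close>
  have "embedded_polygon E_list" "int_off_edges (16, 35) E_list" "int_crossing_sum (16, 35) E_list = 1"
    by code_simp+
  then show "admissible_polygon (map pt E_list)"
    using admissible_polygon_map_pt no_three_collinear_lists(2) by blast
qed

lemma zp_stabbing_info_lists_eq:
  "zp_stabbing_info (map pt I_list) = zp_stabbing_info (map pt E_list)"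
proof -
  have "zp_table I_list = zp_table E_list" by code_simp
  moreover have "length I_list = length E_list" by (simp add: length_lists)
  ultimately show ?thesis
    by (simp only: zp_stabbing_info_map_pt[OF no_three_collinear_lists(1)]
        zp_stabbing_info_map_pt[OF no_three_collinear_lists(2)])
qed

lemma visibility_edge_lists: "visibility_edge (map pt I_list) 0 8" "visibility_edge (map pt E_list) 0 8"
proof -
  have "filter (crosses_segment (I_list ! 0) (I_list ! 8)) (polygon_edges I_list) = []"
    "filter (crosses_segment (E_list ! 0) (E_list ! 8)) (polygon_edges E_list) = []"
    by code_simp+
  then show "visibility_edge (map pt I_list) 0 8" "visibility_edge (map pt E_list) 0 8"
    by (simp_all add: length_lists visibility_edge_def Body_map_pt no_three_collinear_lists)
qed

lemma not_adjacent_0_8: "length P = 12 \<Longrightarrow> \<not> adjacent_vertices P 0 8"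
  by (simp add: adjacent_vertices_def next_vertex_def)

lemma I_edge_I_list: "I_edge (map pt I_list) 0 8"
proof (rule visibility_edge_side(1))
  show "simple_polygon (map pt I_list)"
    using admissible_lists(1) by (simp add: admissible_polygon_def)
  have "pt (69, 39) = midpoint (map pt I_list ! 0) (map pt I_list ! 8)"
    by (simp add: I_list_def midpoint_def complex_eq_iff)
  then show "pt (69, 39) \<in> open_segment (map pt I_list ! 0) (map pt I_list ! 8)"
    by (simp add: I_list_def)
  have "int_off_edges (69, 39) I_list" "int_crossing_sum (69, 39) I_list = 1"
    by code_simp+
  then show "winding_number (polygon_path (map pt I_list)) (pt (69, 39)) \<noteq> 0"
    using winding_number_map_pt(1)[of I_list "(69, 39)"] by (simp add: I_list_def)
qed (simp_all add: visibility_edge_lists not_adjacent_0_8 length_lists)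

lemma E_edge_E_list: "E_edge (map pt E_list) 0 8"
proof (rule visibility_edge_side(2))
  show "simple_polygon (map pt E_list)"
    using admissible_lists(2) by (simp add: admissible_polygon_def)
  have "pt (22, 11) = midpoint (map pt E_list ! 0) (map pt E_list ! 8)"
    by (simp add: E_list_def midpoint_def complex_eq_iff)
  then show "pt (22, 11) \<in> open_segment (map pt E_list ! 0) (map pt E_list ! 8)"
    by (simp add: E_list_def)
  have "int_off_edges (22, 11) E_list" "int_crossing_sum (22, 11) E_list = 0"
    by code_simp+
  then show "winding_number (polygon_path (map pt E_list)) (pt (22, 11)) = 0"
    using winding_number_map_pt(1)[of E_list "(22, 11)"] by (simp add: E_list_def)
qed (simp_all add: visibility_edge_lists not_adjacent_0_8 length_lists)

theorem mainTheorem1: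
  "(\<exists>P P'. admissible_polygon P \<and> admissible_polygon P' \<and>
      length P = 12 \<and> length P' = 12 \<and>
      zp_stabbing_info P = zp_stabbing_info P' \<and>
      I_edge P 0 8 \<and> E_edge P' 0 8) \<and>
   \<not> zp_distinguishes_internal_external"
proof
  show "\<exists>P P'. admissible_polygon P \<and> admissible_polygon P' \<and>
      length P = 12 \<and> length P' = 12 \<and>
      zp_stabbing_info P = zp_stabbing_info P' \<and> I_edge P 0 8 \<and> E_edge P' 0 8"
    using admissible_lists zp_stabbing_info_lists_eq I_edge_I_list E_edge_E_list
    by (intro exI[of _ "map pt I_list"] exI[of _ "map pt E_list"])
      (simp add: length_lists)
  \<comment> \<open>For the common stabbing information a distinguishing function would have to
    answer both yes and no at the pair (0, 8).\<close>
  then show "\<not> zp_distinguishes_internal_external"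
    unfolding zp_distinguishes_internal_external_def by metis
qed

end
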